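(* Let $G_p$ be a Gaussian Mersenne prime. If $G_p=x^2+7y^2$ with $x,y\in\mathbb{Z}$, then $x\equiv\pm1\pmod 8$ and $4\mid y$.
   Context: For a rational prime $p$, the Gaussian Mersenne number is $\mu_p=(1\pm i)^p-1\in\mathbb{Z}[i]$, and $G_p=N(\mu_p)$ is its norm; for odd $p$ one has $G_p=2^{p}-\left(\frac{2}{p}\right)2^{\frac{p+1}{2}}+1$, where $\left(\frac{2}{p}\right)$ is the Legendre symbol. If $G_p$ is a rational prime it is called a Gaussian Mersenne prime. *)

theory Defs
  imports Complex_Main "HOL-Number_Theory.Cong" "HOL-Computational_Algebra.Primes"
begin

text \<open>The ring of Gaussian integers, realised as a subset of the complex numbers.\<close>

definition gauss_ints :: "complex set" where
  "gauss_ints = {of_int a + \<i> * of_int b | a b. True}"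

text \<open>The norm takes integer values on the Gaussian integers, so the floor only changes the type
  (see \<open>of_int_gauss_norm\<close>); the value outside \<^const>\<open>gauss_ints\<close> is irrelevant.\<close>

definition gauss_norm :: "complex \<Rightarrow> int" where
  "gauss_norm z = \<lfloor>(cmod z)\<^sup>2\<rfloor>"

definition gaussian_mersenne :: "nat \<Rightarrow> complex" where
  "gaussian_mersenne p = (1 + \<i>) ^ p - 1"

text \<open>Replacing \<open>1 + \<i>\<close> by \<open>1 - \<i>\<close> gives the same norm
  (see \<open>gauss_norm_conjugate_choice\<close>).\<close>

definition gaussian_mersenne_norm :: "nat \<Rightarrow> int" where
  "gaussian_mersenne_norm p = gauss_norm (gaussian_mersenne p)"

lemma gauss_ints_iff: "z \<in> gauss_ints \<longleftrightarrow> Re z \<in> \<int> \<and> Im z \<in> \<int>"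
  unfolding gauss_ints_def Ints_def by (auto simp: complex_eq_iff)

lemma of_int_gauss_norm:
  assumes "z \<in> gauss_ints"
  shows "of_int (gauss_norm z) = z * cnj z"
proof -
  obtain a b :: int where "z = of_int a + \<i> * of_int b"
    using assms unfolding gauss_ints_def by blast
  then have "(cmod z)\<^sup>2 = of_int (a\<^sup>2 + b\<^sup>2)"
    by (simp add: cmod_power2)
  then have "of_int (gauss_norm z) = complex_of_real ((cmod z)\<^sup>2)"
    unfolding gauss_norm_def by (simp only: floor_of_int of_real_of_int_eq)
  then show ?thesis
    by (simp only: complex_norm_square)
qed

lemma gaussian_mersenne_in_gauss_ints: "gaussian_mersenne p \<in> gauss_ints"
proof -
  have "(1 + \<i>) ^ p \<in> gauss_ints"
    by (induction p) (auto simp: gauss_ints_iff)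
  then show ?thesis
    by (auto simp: gaussian_mersenne_def gauss_ints_iff)
qed

lemma gauss_norm_conjugate_choice:
  "gauss_norm ((1 - \<i>) ^ p - 1) = gaussian_mersenne_norm p"
proof -
  have "(1 - \<i>) ^ p - 1 = cnj (gaussian_mersenne p)"
    by (simp add: gaussian_mersenne_def)
  then show ?thesis
    by (simp add: gaussian_mersenne_norm_def gauss_norm_def)
qed

end

theory Submission
  imports Defs
begin

text \<open>Since \<open>(1 + \<i>) ^ 6 = -8\<i>\<close>, the norm is congruent to 1 modulo 16 as soon as \<open>p \<ge> 6\<close>,
  and modulo 16 the equation leaves only the claimed residues. The small primes 2, 3 and 5 give
  the norms 5, 13 and 41, which are not represented because they are non-squares modulo 7.\<close>

lemma gauss_norm_of_int: "gauss_norm (of_int a + \<i> * of_int b) = a\<^sup>2 + b\<^sup>2"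
proof -
  have "(cmod (of_int a + \<i> * of_int b))\<^sup>2 = of_int (a\<^sup>2 + b\<^sup>2)"
    by (simp add: cmod_power2)
  then show ?thesis
    unfolding gauss_norm_def by (simp only: floor_of_int)
qed

lemma one_plus_ii_power_6: "(1 + \<i>) ^ 6 = - 8 * \<i>"
  by (simp add: eval_nat_numeral algebra_simps)

text \<open>The factor \<open>-8 * \<i>\<close> makes the Gaussian Mersenne number congruent to -1
  modulo 8 in the Gaussian integers. Its norm then gains a factor 2 in the modulus: besides 1, the
  expansion has multiples of 64 and the cross term \<open>- 16 * b\<close>.\<close>

lemma gaussian_mersenne_norm_mod_16:
  assumes "6 \<le> p"
  shows "gaussian_mersenne_norm p mod 16 = 1"
proof -
  obtain k where p: "p = 6 + k"
    using assms le_Suc_ex by blast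
  have "(1 + \<i>) ^ k \<in> gauss_ints"
    by (induction k) (auto simp: gauss_ints_iff)
  then obtain a b :: int where ab: "(1 + \<i>) ^ k = of_int a + \<i> * of_int b"
    unfolding gauss_ints_def by blast
  have "(1 + \<i>) ^ p = - 8 * \<i> * (of_int a + \<i> * of_int b)"
    by (simp only: p power_add one_plus_ii_power_6 ab)
  then have "gaussian_mersenne p = of_int (8 * b - 1) + \<i> * of_int (- 8 * a)"
    by (simp add: gaussian_mersenne_def algebra_simps)
  then have "gaussian_mersenne_norm p = (8 * b - 1)\<^sup>2 + (- 8 * a)\<^sup>2"
    by (simp only: gaussian_mersenne_norm_def gauss_norm_of_int)
  also have "\<dots> = 1 + 16 * (4 * b\<^sup>2 - b + 4 * a\<^sup>2)"
    by (simp add: power2_eq_square algebra_simps)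
  finally show ?thesis
    by (simp only: mod_mult_self2) simp
qed

lemma gaussian_mersenne_norm_small:
  "gaussian_mersenne_norm 2 = 5"
  "gaussian_mersenne_norm 3 = 13"
  "gaussian_mersenne_norm 5 = 41"
proof -
  have "gaussian_mersenne 2 = of_int (- 1) + \<i> * of_int 2"
    "gaussian_mersenne 3 = of_int (- 3) + \<i> * of_int 2"
    "gaussian_mersenne 5 = of_int (- 5) + \<i> * of_int (- 4)"
    by (simp_all add: gaussian_mersenne_def eval_nat_numeral algebra_simps)
  then show "gaussian_mersenne_norm 2 = 5" "gaussian_mersenne_norm 3 = 13"
    "gaussian_mersenne_norm 5 = 41"
    by (simp_all only: gaussian_mersenne_norm_def gauss_norm_of_int) simp_all
qed

text \<open>The term with 7 vanishes, and 0, 1, 2, 4 are the squares modulo 7.\<close>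

lemma square_plus_7_square_mod_7:
  fixes x y :: int
  shows "(x\<^sup>2 + 7 * y\<^sup>2) mod 7 \<in> {0, 1, 2, 4}"
proof -
  have "x mod 7 \<in> {0, 1, 2, 3, 4, 5, 6}"
    by (simp, presburger)
  moreover have "(x\<^sup>2 + 7 * y\<^sup>2) mod 7 = (x mod 7)\<^sup>2 mod 7"
    by (simp add: power_mod)
  ultimately show ?thesis
    by auto
qed

text \<open>The cross term of \<open>(8 * q + r)\<^sup>2\<close> is divisible by 16, so residues
  modulo 8 suffice for the case check that follows.\<close>

lemma square_mod_16:
  fixes x :: int
  shows "x\<^sup>2 mod 16 = (x mod 8)\<^sup>2 mod 16"
proof -
  define q r where "q = x div 8" and "r = x mod 8"
  have "x = 8 * q + r"
    by (simp add: q_def r_def)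
  then have "x\<^sup>2 = r\<^sup>2 + 16 * (4 * q\<^sup>2 + q * r)"
    by (simp add: power2_eq_square algebra_simps)
  then show ?thesis
    unfolding r_def[symmetric] by (simp only: mod_mult_self2)
qed

text \<open>Squares modulo 16 are 0, 1, 4, 9. Taking \<open>y\<^sup>2\<close> to be 1, 4 or 9 would
  force \<open>x\<^sup>2\<close> to be 10, 5 or 2, none of which is a square. Hence 16 divides
  \<open>y\<^sup>2\<close>, and \<open>x\<^sup>2\<close> is 1 modulo 16.\<close>

lemma square_plus_7_square_mod_16:
  fixes x y :: int
  assumes "(x\<^sup>2 + 7 * y\<^sup>2) mod 16 = 1"
  shows "(x mod 8 = 1 \<or> x mod 8 = 7) \<and> 4 dvd y"
proof -
  have "[x\<^sup>2 mod 16 + 7 * (y\<^sup>2 mod 16) = x\<^sup>2 + 7 * y\<^sup>2] (mod 16)"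
    by (intro cong_add cong_mult cong_refl) simp_all
  then have "(x\<^sup>2 mod 16 + 7 * (y\<^sup>2 mod 16)) mod 16 = 1"
    using assms unfolding cong_def by (rule trans)
  then have eq: "((x mod 8)\<^sup>2 mod 16 + 7 * ((y mod 8)\<^sup>2 mod 16)) mod 16 = 1"
    unfolding square_mod_16[of x] square_mod_16[of y] .
  have residues: "z mod 8 \<in> {0, 1, 2, 3, 4, 5, 6, 7}" for z :: int
    by (simp, presburger)
  \<comment> \<open>With \<open>r\<close> and \<open>s\<close> as variables, the split into 64 pairs
    leaves only arithmetic on numerals.\<close>
  have "(r = 1 \<or> r = 7) \<and> (s = 0 \<or> s = 4)"
    if "r \<in> {0, 1, 2, 3, 4, 5, 6, 7}" "s \<in> {0, 1, 2, 3, 4, 5, 6, 7}"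
      "(r\<^sup>2 mod 16 + 7 * (s\<^sup>2 mod 16)) mod 16 = 1" for r s :: int
    using that by (elim insertE emptyE) simp_all
  from this[OF residues residues eq]
  have "x mod 8 = 1 \<or> x mod 8 = 7" and "y mod 8 = 0 \<or> y mod 8 = 4"
    by blast+
  moreover from this(2) have "4 dvd y"
    by presburger
  ultimately show ?thesis
    by blast
qed

theorem lemma2p4:
  fixes p :: nat and x y :: int
  assumes "prime p"
    and "prime (gaussian_mersenne_norm p)"
    and "gaussian_mersenne_norm p = x\<^sup>2 + 7 * y\<^sup>2"
  shows "([x = 1] (mod 8) \<or> [x = - 1] (mod 8)) \<and> 4 dvd y"
proof (cases "6 \<le> p")
  case True
  then have "(x mod 8 = 1 \<or> x mod 8 = 7) \<and> 4 dvd y"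
    using gaussian_mersenne_norm_mod_16[of p] assms(3)
    by (simp add: square_plus_7_square_mod_16)
  then show ?thesis
    by (simp add: cong_def)
next
  case False
  \<comment> \<open>The exponent 4 gives the norm 25, a square modulo 7, which the test below would
    not exclude.\<close>
  have "p \<noteq> 4"
    using assms(1) by auto
  then have "p = 2 \<or> p = 3 \<or> p = 5"
    using False prime_ge_2_nat[OF assms(1)] by linarith
  \<comment> \<open>The norms 5, 13 and 41 leave the remainders 5, 6 and 6 modulo 7.\<close>
  then have False
    using square_plus_7_square_mod_7[of x y] gaussian_mersenne_norm_small
    unfolding assms(3)[symmetric] by auto
  then show ?thesis ..
qed

end
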